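(* Let $0<q<1$, $\alpha\ge0$ and $m\in\mathbb{N}_0$. Then, for every $x\in[0,1]$, $$S_\infty^{q,\alpha}(e_{m+1};x)=S_\infty^{q,\alpha}(e_m;x)-(1-x)\,S_\infty^{q,\frac{q\alpha}{1+\alpha}}\left(e_m;\frac{qx}{1+\alpha}\right).$$
   Context: Write $e_m(t)=t^m$. The $q$-Pochhammer symbols are $(a;q)_0=1$, $(a;q)_m=\prod_{j=0}^{m-1}(1-aq^j)$, $(a;q)_\infty=\prod_{j=0}^\infty(1-aq^j)$. Empty products equal $1$ and $0^0=1$. For $\alpha\ge0$, $k\in\mathbb{N}_0$ and $x\in[0,1]$ let $$p_{\infty k}^{q,\alpha}(x)=\frac{\left(\frac{\gamma}{x+\gamma};q\right)_k\left(\frac{x+\gamma}{1+\gamma};q\right)_\infty\left(\frac{x+\gamma}{1+\gamma}\right)^k}{(q;q)_k\left(\frac{\gamma}{1+\gamma};q\right)_\infty},\qquad \gamma=\frac{\alpha}{1-q},$$ where the product $\left(\frac{\gamma}{x+\gamma};q\right)_k\left(\frac{x+\gamma}{1+\gamma}\right)^k$ is read as $(1+\gamma)^{-k}\prod_{i=0}^{k-1}(x+\gamma-\gamma q^i)$ (relevant only when $x=\gamma=0$). The limit $q$-Stancu operator on $f\in C[0,1]$ is $$S_\infty^{q,\alpha}(f;x)=\sum_{k=0}^\infty f(1-q^k)\,p_{\infty k}^{q,\alpha}(x)\ \text{ for } x\in[0,1),\qquad S_\infty^{q,\alpha}(f;1)=f(1).$$ *)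

theory Defs
  imports "HOL-Analysis.Analysis"
begin

definition qpoch :: "real \<Rightarrow> real \<Rightarrow> nat \<Rightarrow> real" where
  "qpoch a q m = (\<Prod>j<m. 1 - a * q ^ j)"

definition qpoch_inf :: "real \<Rightarrow> real \<Rightarrow> real" where
  "qpoch_inf a q = (\<Prod>j. 1 - a * q ^ j)"

definition stancu_gamma :: "real \<Rightarrow> real \<Rightarrow> real" where
  "stancu_gamma q \<alpha> = \<alpha> / (1 - q)"

text \<open>
  For \<open>x = \<gamma> = 0\<close> the quotient \<open>\<gamma> / (x + \<gamma>)\<close> is \<open>0\<close> by the convention on division by
  zero; lemma \<open>stancu_product_reading\<close> below shows that the displayed product
  then still takes the intended value.
\<close>
definition stancu_basis :: "real \<Rightarrow> real \<Rightarrow> nat \<Rightarrow> real \<Rightarrow> real" where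
  "stancu_basis q \<alpha> k x =
    (let \<gamma> = stancu_gamma q \<alpha> in
      (qpoch (\<gamma> / (x + \<gamma>)) q k * qpoch_inf ((x + \<gamma>) / (1 + \<gamma>)) q * ((x + \<gamma>) / (1 + \<gamma>)) ^ k)
      / (qpoch q q k * qpoch_inf (\<gamma> / (1 + \<gamma>)) q))"

lemma stancu_product_reading:
  fixes x \<gamma> q :: real
  assumes "0 \<le> x" "0 \<le> \<gamma>"
  shows "qpoch (\<gamma> / (x + \<gamma>)) q k * ((x + \<gamma>) / (1 + \<gamma>)) ^ k
       = inverse ((1 + \<gamma>) ^ k) * (\<Prod>i<k. x + \<gamma> - \<gamma> * q ^ i)"
proof (induction k)
  case 0
  show ?case by (simp add: qpoch_def)
next
  case (Suc k)
  have step: "(1 - \<gamma> / (x + \<gamma>) * q ^ k) * ((x + \<gamma>) / (1 + \<gamma>))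
      = inverse (1 + \<gamma>) * (x + \<gamma> - \<gamma> * q ^ k)"
  proof (cases "x + \<gamma> = 0")
    case True
    with assms have "x = 0" "\<gamma> = 0" by linarith+
    then show ?thesis by simp
  next
    case False
    then have "(1 - \<gamma> / (x + \<gamma>) * q ^ k) * (x + \<gamma>) = x + \<gamma> - \<gamma> * q ^ k"
      by (simp add: left_diff_distrib)
    then show ?thesis by (simp add: divide_inverse mult.assoc [symmetric])
  qed
  have "qpoch (\<gamma> / (x + \<gamma>)) q (Suc k) * ((x + \<gamma>) / (1 + \<gamma>)) ^ Suc k
      = (qpoch (\<gamma> / (x + \<gamma>)) q k * ((x + \<gamma>) / (1 + \<gamma>)) ^ k)
        * ((1 - \<gamma> / (x + \<gamma>) * q ^ k) * ((x + \<gamma>) / (1 + \<gamma>)))"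
    by (simp only: qpoch_def prod.lessThan_Suc power_Suc mult_ac)
  also have "\<dots> = inverse ((1 + \<gamma>) ^ Suc k) * (\<Prod>i<Suc k. x + \<gamma> - \<gamma> * q ^ i)"
    unfolding Suc.IH step
    by (simp only: prod.lessThan_Suc power_Suc inverse_mult_distrib mult_ac)
  finally show ?case .
qed

definition limit_q_stancu :: "real \<Rightarrow> real \<Rightarrow> (real \<Rightarrow> real) \<Rightarrow> real \<Rightarrow> real" where
  "limit_q_stancu q \<alpha> f x =
    (if x = 1 then f 1 else (\<Sum>k. f (1 - q ^ k) * stancu_basis q \<alpha> k x))"

definition monomial_fun :: "nat \<Rightarrow> real \<Rightarrow> real" where
  "monomial_fun m t = t ^ m"

end

theory Submission imports Defs begin

text \<open>
  With \<open>a = \<gamma> / (x + \<gamma>)\<close> and \<open>z = (x + \<gamma>) / (1 + \<gamma>)\<close> the \<open>k\<close>-th basis function at \<open>x\<close> is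
  \<open>(a; q)\<^sub>k (z; q)\<^sub>\<infinity> z\<^sup>k / ((q; q)\<^sub>k (a z; q)\<^sub>\<infinity>)\<close>, because \<open>a z = \<gamma> / (1 + \<gamma>)\<close>.  Passing from
  \<open>(\<alpha>, x)\<close> to \<open>(q \<alpha> / (1 + \<alpha>), q x / (1 + \<alpha>))\<close> keeps \<open>a\<close> and replaces \<open>z\<close> by \<open>q z\<close>
  (\<open>stancu_parameter_shift\<close>).  Since \<open>(z; q)\<^sub>\<infinity> = (1 - z) (q z; q)\<^sub>\<infinity>\<close>, the new basis function is
  the old one times \<open>q\<^sup>k (1 - a z) / (1 - z)\<close>, and \<open>(1 - z) / (1 - a z) = 1 - x\<close>.  This gives
  \<open>stancu_basis_shift\<close>: multiplication of a basis function by \<open>q\<^sup>k\<close> equals the parameter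
  change followed by multiplication with \<open>1 - x\<close>.

  At the node \<open>t = 1 - q\<^sup>k\<close> we have \<open>t\<^sup>m\<^sup>+\<^sup>1 = t\<^sup>m - q\<^sup>k t\<^sup>m\<close>, so for \<open>x < 1\<close> the recurrence follows
  by summing over \<open>k\<close>; the series converge because the basis functions are bounded
  by a constant multiple of \<open>c\<^sup>k\<close> for any \<open>c\<close> strictly between \<open>z\<close> and \<open>1\<close>.  At \<open>x = 1\<close> both sides equal \<open>1\<close>.
\<close>

lemma qpoch_inf_rec:
  assumes "0 \<le> a" "a < 1" "0 < q" "q < 1"
  shows "qpoch_inf a q = (1 - a) * qpoch_inf (q * a) q"
proof -
  let ?f = "\<lambda>j. 1 - a * q ^ j"
  have nz: "?f j \<noteq> 0" for j
  proof -
    have "a * q ^ j \<le> a * 1"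
      using assms by (intro mult_left_mono power_le_one) auto
    with assms show ?thesis by linarith
  qed
  have "summable (\<lambda>j. a * q ^ j)"
    using assms by (intro summable_mult summable_geometric) auto
  then have "summable (\<lambda>j. norm (?f j - 1))"
    using assms by simp
  then have "convergent_prod ?f"
    by (intro abs_convergent_prod_imp_convergent_prod)
       (simp add: abs_convergent_prod_conv_summable)
  then have "prodinf (\<lambda>j. ?f (j + 1)) = prodinf ?f / (\<Prod>j<1. ?f j)"
    by (rule prodinf_divide_initial_segment) (rule nz)
  then show ?thesis
    using assms(2) by (simp add: qpoch_inf_def field_simps)
qed

lemma stancu_parameter_shift:
  fixes q \<alpha> x :: real
  assumes "0 < q" "q < 1" "0 \<le> \<alpha>"
  defines "\<gamma> \<equiv> stancu_gamma q \<alpha>"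
    and "\<gamma>' \<equiv> stancu_gamma q (q * \<alpha> / (1 + \<alpha>))"
    and "x' \<equiv> q * x / (1 + \<alpha>)"
  shows "\<gamma>' / (x' + \<gamma>') = \<gamma> / (x + \<gamma>)"
    and "(x' + \<gamma>') / (1 + \<gamma>') = q * ((x + \<gamma>) / (1 + \<gamma>))"
    and "\<gamma>' / (1 + \<gamma>') = q * (\<gamma> / (1 + \<gamma>))"
proof -
  define c where "c = q / (1 + \<alpha>)"
  have c: "c \<noteq> 0" "q = c * (1 + \<alpha>)" using assms by (auto simp: c_def)
  have g: "\<gamma>' = c * \<gamma>" "x' = c * x"
    by (simp_all add: \<gamma>'_def \<gamma>_def x'_def c_def stancu_gamma_def)
  have \<alpha>: "\<alpha> = \<gamma> * (1 - q)" using assms by (simp add: \<gamma>_def stancu_gamma_def)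
  have "(1 + \<alpha>) * (1 + \<gamma>') = 1 + \<alpha> + q * \<gamma>"
    unfolding g(1) using c(2) by (simp add: algebra_simps)
  \<comment> \<open>The relation that turns the scaling factor \<open>q / (1 + \<alpha>)\<close> of both \<open>x\<close> and \<open>\<gamma>\<close> into \<open>q\<close>.\<close>
  also have "\<dots> = 1 + \<gamma>" by (subst \<alpha>) (simp add: algebra_simps)
  finally have \<gamma>'_rel: "(1 + \<alpha>) * (1 + \<gamma>') = 1 + \<gamma>" .
  have d: "(c * y) / (1 + \<gamma>') = q * (y / (1 + \<gamma>))" for y
    unfolding \<gamma>'_rel[symmetric] using assms(3) by (simp add: c_def)
  show "\<gamma>' / (x' + \<gamma>') = \<gamma> / (x + \<gamma>)"
    using c(1) by (simp add: g flip: distrib_left)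
  show "(x' + \<gamma>') / (1 + \<gamma>') = q * ((x + \<gamma>) / (1 + \<gamma>))"
    using d[of "x + \<gamma>"] by (simp add: g distrib_left)
  show "\<gamma>' / (1 + \<gamma>') = q * (\<gamma> / (1 + \<gamma>))"
    using d[of \<gamma>] by (simp add: g)
qed

lemma stancu_basis_shift:
  fixes q \<alpha> x :: real
  assumes "0 < q" "q < 1" "0 \<le> \<alpha>" "0 \<le> x" "x < 1"
  shows "q ^ k * stancu_basis q \<alpha> k x
       = (1 - x) * stancu_basis q (q * \<alpha> / (1 + \<alpha>)) k (q * x / (1 + \<alpha>))"
proof -
  define \<gamma> where "\<gamma> = stancu_gamma q \<alpha>"
  define z where "z = (x + \<gamma>) / (1 + \<gamma>)"
  define w where "w = \<gamma> / (1 + \<gamma>)"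
  have \<gamma>: "0 \<le> \<gamma>" using assms by (simp add: \<gamma>_def stancu_gamma_def)
  have z: "0 \<le> z" "z < 1" and w: "0 \<le> w" "w < 1"
    using assms \<gamma> by (simp_all add: z_def w_def)
  have zw: "1 - z = (1 - x) * (1 - w)"
    using \<gamma> by (simp add: z_def w_def field_simps)
  have w1: "1 - w \<noteq> 0" using w by simp
  have lhs: "stancu_basis q \<alpha> k x
      = (qpoch (\<gamma> / (x + \<gamma>)) q k * ((1 - x) * (1 - w) * qpoch_inf (q * z) q) * z ^ k)
        / (qpoch q q k * ((1 - w) * qpoch_inf (q * w) q))"
    unfolding stancu_basis_def Let_def \<gamma>_def[symmetric] z_def[symmetric] w_def[symmetric]
    using qpoch_inf_rec[OF z assms(1,2)] qpoch_inf_rec[OF w assms(1,2)] by (simp add: zw)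
  have rhs: "stancu_basis q (q * \<alpha> / (1 + \<alpha>)) k (q * x / (1 + \<alpha>))
      = (qpoch (\<gamma> / (x + \<gamma>)) q k * qpoch_inf (q * z) q * (q * z) ^ k)
        / (qpoch q q k * qpoch_inf (q * w) q)"
    unfolding stancu_basis_def Let_def stancu_parameter_shift[OF assms(1-3)]
    by (simp add: \<gamma>_def z_def w_def)
  show ?thesis
    unfolding lhs rhs using w1 by (simp add: power_mult_distrib)
qed

text \<open>
  Each basis function arises from its predecessor by the factor
  \<open>z (1 - a q\<^sup>k) / (1 - q\<^sup>k\<^sup>+\<^sup>1)\<close> with \<open>0 \<le> a \<le> 1\<close>, which tends to \<open>z < 1\<close>; the ratio
  test applies.
\<close>
lemma summable_stancu_basis:
  fixes q \<alpha> x :: real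
  assumes "0 < q" "q < 1" "0 \<le> \<alpha>" "0 \<le> x" "x < 1"
  shows "summable (\<lambda>k. \<bar>stancu_basis q \<alpha> k x\<bar>)"
proof -
  define \<gamma> where "\<gamma> = stancu_gamma q \<alpha>"
  define z where "z = (x + \<gamma>) / (1 + \<gamma>)"
  define a where "a = \<gamma> / (x + \<gamma>)"
  have \<gamma>: "0 \<le> \<gamma>" using assms by (simp add: \<gamma>_def stancu_gamma_def)
  have z: "0 \<le> z" "z < 1" using assms \<gamma> by (simp_all add: z_def)
  have a: "0 \<le> a" "a \<le> 1"
    using assms \<gamma> by (auto simp: a_def divide_le_eq_1)
  obtain c where c: "z < c" "c < 1" using z dense by blast
  have "(\<lambda>k. z / (1 - q ^ Suc k)) \<longlonglongrightarrow> z / (1 - 0)"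
    using assms by (intro tendsto_intros LIMSEQ_Suc LIMSEQ_realpow_zero) auto
  then have "\<forall>\<^sub>F k in sequentially. z / (1 - q ^ Suc k) < c"
    using c by (intro order_tendstoD) auto
  then obtain N where N: "\<And>k. k \<ge> N \<Longrightarrow> z / (1 - q ^ Suc k) < c"
    by (auto simp: eventually_sequentially)
  have ratio: "\<bar>stancu_basis q \<alpha> (Suc k) x\<bar> \<le> c * \<bar>stancu_basis q \<alpha> k x\<bar>" if "k \<ge> N" for k
  proof -
    have q1: "0 < 1 - q ^ Suc k"
      using assms power_Suc_less_one[of q k] by auto
    have "a * q ^ k \<le> 1 * 1"
      using a assms by (intro mult_mono power_le_one) auto
    then have f: "0 \<le> 1 - a * q ^ k" "1 - a * q ^ k \<le> 1"
      using a assms by auto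
    have "stancu_basis q \<alpha> (Suc k) x
        = (1 - a * q ^ k) * (z / (1 - q ^ Suc k)) * stancu_basis q \<alpha> k x"
      unfolding stancu_basis_def Let_def \<gamma>_def[symmetric] a_def[symmetric] z_def[symmetric]
      by (simp add: qpoch_def mult_ac)
    also have "\<bar>\<dots>\<bar> = (1 - a * q ^ k) * (z / (1 - q ^ Suc k)) * \<bar>stancu_basis q \<alpha> k x\<bar>"
      using f z q1 by (simp add: abs_mult)
    also have "\<dots> \<le> (1 * c) * \<bar>stancu_basis q \<alpha> k x\<bar>"
      using f z q1 N[OF that] by (intro mult_right_mono mult_mono) auto
    finally show ?thesis by simp
  qed
  show ?thesis
    by (rule summable_ratio_test[OF c(2), of N]) (use ratio in auto)
qed

lemma summable_monomial_stancu:
  fixes q \<alpha> x :: real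
  assumes "0 < q" "q < 1" "0 \<le> \<alpha>" "0 \<le> x" "x < 1"
  shows "summable (\<lambda>k. monomial_fun m (1 - q ^ k) * stancu_basis q \<alpha> k x)"
proof (rule summable_comparison_test'[OF summable_stancu_basis[OF assms]])
  fix k :: nat
  have "0 \<le> 1 - q ^ k" "1 - q ^ k \<le> 1"
    using assms by (auto simp: power_le_one)
  then have "\<bar>(1 - q ^ k) ^ m\<bar> \<le> 1"
    by (simp add: power_le_one)
  then show "norm (monomial_fun m (1 - q ^ k) * stancu_basis q \<alpha> k x) \<le> \<bar>stancu_basis q \<alpha> k x\<bar>"
    by (simp add: monomial_fun_def abs_mult mult_left_le_one_le)
qed

theorem theorem3p10:
  fixes q \<alpha> x :: real and m :: nat
  assumes "0 < q" and "q < 1" and "0 \<le> \<alpha>" and "x \<in> {0..1}"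
  shows "limit_q_stancu q \<alpha> (monomial_fun (m + 1)) x
       = limit_q_stancu q \<alpha> (monomial_fun m) x
         - (1 - x) * limit_q_stancu q (q * \<alpha> / (1 + \<alpha>)) (monomial_fun m) (q * x / (1 + \<alpha>))"
proof (cases "x = 1")
  case True
  then show ?thesis by (simp add: limit_q_stancu_def monomial_fun_def)
next
  case False
  with assms have x: "0 \<le> x" "x < 1" by auto
  define \<alpha>' where "\<alpha>' = q * \<alpha> / (1 + \<alpha>)"
  define x' where "x' = q * x / (1 + \<alpha>)"
  have "q * x < 1 * 1"
    using assms x by (intro mult_strict_mono) auto
  then have x': "0 \<le> x'" "x' < 1" and \<alpha>': "0 \<le> \<alpha>'"
    using assms x by (auto simp: x'_def \<alpha>'_def)
  let ?s = "\<lambda>k. monomial_fun m (1 - q ^ k) * stancu_basis q \<alpha> k x"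
  let ?s' = "\<lambda>k. monomial_fun m (1 - q ^ k) * stancu_basis q \<alpha>' k x'"
  have sum: "summable ?s" and sum': "summable ?s'"
    using assms x x' \<alpha>' by (auto intro: summable_monomial_stancu)
  have "monomial_fun (m + 1) (1 - q ^ k) * stancu_basis q \<alpha> k x = ?s k - (1 - x) * ?s' k" for k
  proof -
    have "monomial_fun (m + 1) (1 - q ^ k) * stancu_basis q \<alpha> k x
        = ?s k - monomial_fun m (1 - q ^ k) * (q ^ k * stancu_basis q \<alpha> k x)"
      by (simp add: monomial_fun_def algebra_simps)
    then show ?thesis
      unfolding stancu_basis_shift[OF assms(1-3) x] \<alpha>'_def x'_def by simp
  qed
  then have "limit_q_stancu q \<alpha> (monomial_fun (m + 1)) x = (\<Sum>k. ?s k - (1 - x) * ?s' k)"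
    using False by (simp add: limit_q_stancu_def)
  also have "\<dots> = (\<Sum>k. ?s k) - (1 - x) * (\<Sum>k. ?s' k)"
    using sum sum' by (simp add: suminf_diff[symmetric] suminf_mult summable_mult)
  finally show ?thesis
    using False x'(2) unfolding \<alpha>'_def[symmetric] x'_def[symmetric]
    by (simp add: limit_q_stancu_def)
qed

end
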